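(* Let $g\ge3$ and let $C_g$ be the bare cycle of length $g$ (with any positive weights; the Ricci matrix depends only on degrees and incidences). Then the Ricci matrix $R_{C_g}$ is the circulant matrix with diagonal $-1$ and entry $\tfrac12$ on each cyclic neighbour, so its spectrum is $$\{\cos(2\pi k/g)-1:\ k=0,\dots,g-1\}.$$ The top eigenvalue, attained at $k=0$ by the constant eigenvector, is $\lambda_{\max}(R_{C_g})=0$. For $g\ge6$ the corresponding (constant) weighting has Lin--Lu--Yau curvature $\kappa\equiv0$ on every edge.
   Context: Weighted graphs: $G=(V,E)$ is a finite connected simple graph, $w:E\to\mathbb{R}_{>0}$ an edge weighting, $d_v$ the combinatorial degree, and $d(x,y)$ the least total weight of a path from $x$ to $y$. Lin--Lu--Yau curvature: for $\alpha\in[0,1]$ let $\mu_x^\alpha$ be the probability measure with mass $\alpha$ at $x$ and $(1-\alpha)/d_x$ at each neighbour of $x$. Let $W$ be the $L^1$-Wasserstein distance with respect to $d$. For an edge $x\sim y$ put $\kappa_\alpha(x,y)=1-W(\mu_x^\alpha,\mu_y^\alpha)/d(x,y)$ and $\kappa_{xy}=\lim_{\alpha\to1}\kappa_\alpha(x,y)/(1-\alpha)$. Ricci matrix: $R_G\in\mathbb{R}^{E\times E}$ has diagonal entries $-(1/d_x+1/d_y)$ for $e=\{x,y\}$, entry $1/d_z$ for $e\ne e'$ with $e\cap e'=\{z\}$, and $0$ for disjoint edges; $\lambda_{\max}$ denotes its largest eigenvalue. *)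

theory Defs
  imports
    "HOL-Probability.Probability"
    "Jordan_Normal_Form.Spectral_Radius"
begin

section \<open>Weighted graphs\<close>

record 'v wgraph =
  verts :: "'v set"
  edges :: "'v set set"
  weight :: "'v set \<Rightarrow> real"

definition neighbours :: "('v, 'b) wgraph_scheme \<Rightarrow> 'v \<Rightarrow> 'v set" where
  "neighbours G x = {y. {x, y} \<in> edges G}"

definition degree_of :: "('v, 'b) wgraph_scheme \<Rightarrow> 'v \<Rightarrow> nat" where
  "degree_of G x = card (neighbours G x)"

definition paths :: "('v, 'b) wgraph_scheme \<Rightarrow> 'v \<Rightarrow> 'v \<Rightarrow> 'v list set" where
  "paths G x y = {p. p \<noteq> [] \<and> hd p = x \<and> last p = y \<and> distinct p \<and> set p \<subseteq> verts G \<and>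
     successively (\<lambda>u v. {u, v} \<in> edges G) p}"

definition path_weight :: "('v, 'b) wgraph_scheme \<Rightarrow> 'v list \<Rightarrow> real" where
  "path_weight G p = (\<Sum>i<length p - 1. weight G {p ! i, p ! Suc i})"

text \<open>In a finite connected graph the set of paths from \<open>x\<close> to \<open>y\<close> is finite and nonempty, so
  the infimum is the least path weight.\<close>

definition gdist :: "('v, 'b) wgraph_scheme \<Rightarrow> 'v \<Rightarrow> 'v \<Rightarrow> real" where
  "gdist G x y = Inf (path_weight G ` paths G x y)"

definition weighted_graph :: "('v, 'b) wgraph_scheme \<Rightarrow> bool" where
  "weighted_graph G \<longleftrightarrow>
     finite (verts G) \<and> verts G \<noteq> {} \<and>
     (\<forall>e\<in>edges G. e \<subseteq> verts G \<and> card e = 2) \<and>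
     (\<forall>x\<in>verts G. \<forall>y\<in>verts G. paths G x y \<noteq> {}) \<and>
     (\<forall>e\<in>edges G. weight G e > 0)"


section \<open>Lin--Lu--Yau curvature\<close>

definition lazy_measure :: "('v, 'b) wgraph_scheme \<Rightarrow> real \<Rightarrow> 'v \<Rightarrow> 'v pmf" where
  "lazy_measure G \<alpha> x =
     bind_pmf (bernoulli_pmf \<alpha>)
       (\<lambda>stay. if stay then return_pmf x else pmf_of_set (neighbours G x))"

lemma pmf_lazy_measure:
  assumes "0 \<le> \<alpha>" "\<alpha> \<le> 1" "finite (neighbours G x)" "neighbours G x \<noteq> {}" "x \<notin> neighbours G x"
  shows "pmf (lazy_measure G \<alpha> x) v =
    (if v = x then \<alpha> else if v \<in> neighbours G x then (1 - \<alpha>) / degree_of G x else 0)"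
  using assms
  by (auto simp: lazy_measure_def degree_of_def pmf_bind indicator_def)

definition couplings :: "'v pmf \<Rightarrow> 'v pmf \<Rightarrow> ('v \<times> 'v) pmf set" where
  "couplings \<mu> \<nu> = {\<pi>. map_pmf fst \<pi> = \<mu> \<and> map_pmf snd \<pi> = \<nu>}"

definition wasserstein :: "('v, 'b) wgraph_scheme \<Rightarrow> 'v pmf \<Rightarrow> 'v pmf \<Rightarrow> real" where
  "wasserstein G \<mu> \<nu> =
     (INF \<pi>\<in>couplings \<mu> \<nu>. measure_pmf.expectation \<pi> (\<lambda>(u, v). gdist G u v))"

definition lazy_curvature :: "('v, 'b) wgraph_scheme \<Rightarrow> real \<Rightarrow> 'v \<Rightarrow> 'v \<Rightarrow> real" where
  "lazy_curvature G \<alpha> x y =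
     1 - wasserstein G (lazy_measure G \<alpha> x) (lazy_measure G \<alpha> y) / gdist G x y"

text \<open>The curvature is a relation, so that asserting a value includes existence of the limit.\<close>

definition has_LLY_curvature :: "('v, 'b) wgraph_scheme \<Rightarrow> 'v \<Rightarrow> 'v \<Rightarrow> real \<Rightarrow> bool" where
  "has_LLY_curvature G x y k \<longleftrightarrow>
     ((\<lambda>\<alpha>. lazy_curvature G \<alpha> x y / (1 - \<alpha>)) \<longlongrightarrow> k) (at_left 1)"


section \<open>The Ricci matrix\<close>

definition ricci_entry :: "('v, 'b) wgraph_scheme \<Rightarrow> 'v set \<Rightarrow> 'v set \<Rightarrow> real" where
  "ricci_entry G e e' =
     (if e = e' then - (\<Sum>x\<in>e. 1 / degree_of G x)
      else if is_singleton (e \<inter> e') then 1 / degree_of G (the_elem (e \<inter> e'))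
      else 0)"

text \<open>Library matrices are indexed by initial segments of the naturals, so rows and columns are
  ordered by a repetition-free enumeration \<open>es\<close> of the edge set. Another enumeration conjugates
  the matrix by a permutation matrix.\<close>

definition ricci_matrix :: "('v, 'b) wgraph_scheme \<Rightarrow> 'v set list \<Rightarrow> real mat" where
  "ricci_matrix G es =
     Matrix.mat (length es) (length es) (\<lambda>(i, j). ricci_entry G (es ! i) (es ! j))"

definition lambda_max :: "real mat \<Rightarrow> real" where
  "lambda_max A = Max (spectrum A)"

definition circulant_mat :: "nat \<Rightarrow> (nat \<Rightarrow> 'a) \<Rightarrow> 'a mat" where
  "circulant_mat n c = Matrix.mat n n (\<lambda>(i, j). c ((j + n - i) mod n))"


section \<open>The cycle\<close>

definition cycle_edges :: "nat \<Rightarrow> nat set list" where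
  "cycle_edges g = map (\<lambda>i. {i, Suc i mod g}) [0..<g]"

definition cycle_graph :: "nat \<Rightarrow> (nat set \<Rightarrow> real) \<Rightarrow> nat wgraph" where
  "cycle_graph g w = \<lparr>verts = {..<g}, edges = set (cycle_edges g), weight = w\<rparr>"

lemma distinct_cycle_edges:
  assumes "3 \<le> g"
  shows "distinct (cycle_edges g)"
proof -
  have "inj_on (\<lambda>i. {i, Suc i mod g}) {0..<g}"
  proof (rule inj_onI)
    fix i j assume "i \<in> {0..<g}" "j \<in> {0..<g}" "{i, Suc i mod g} = {j, Suc j mod g}"
    with assms show "i = j"
      by (auto simp: doubleton_eq_iff mod_Suc split: if_splits)
  qed
  then show ?thesis by (simp add: cycle_edges_def distinct_map)
qed

lemma weighted_graph_cycle:
  assumes "3 \<le> g" and "\<And>e. e \<in> set (cycle_edges g) \<Longrightarrow> w e > 0"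
  shows "weighted_graph (cycle_graph g w)"
proof -
  let ?G = "cycle_graph g w"
  have step: "{i, Suc i} \<in> edges ?G" if "Suc i < g" for i
    using that by (auto simp: cycle_graph_def cycle_edges_def image_iff intro!: bexI[of _ i])
  have up: "[x..<Suc y] \<in> paths ?G x y" if "x \<le> y" "y < g" for x y
    using that step
    by (auto simp: paths_def successively_conv_nth cycle_graph_def nth_append hd_append
        simp del: upt_Suc)
  have down: "rev p \<in> paths ?G y x" if "p \<in> paths ?G x y" for p x y
    using that by (auto simp: paths_def hd_rev last_rev insert_commute)
  have "paths ?G x y \<noteq> {}" if "x < g" "y < g" for x y
    using up[of x y] down[OF up[of y x]] that by (cases "x \<le> y") auto
  moreover have "e \<subseteq> {..<g} \<and> card e = 2" if "e \<in> edges ?G" for e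
  proof -
    from that obtain i where i: "i < g" "e = {i, Suc i mod g}"
      by (auto simp: cycle_graph_def cycle_edges_def)
    have "i \<noteq> Suc i mod g" using i assms(1) by (auto simp: mod_Suc)
    with i assms(1) show ?thesis by auto
  qed
  ultimately show ?thesis
    using assms unfolding weighted_graph_def by (auto simp: cycle_graph_def lessThan_empty_iff)
qed

end

(* The vectors (z^j) with z^g = 1 are eigenvectors of every circulant matrix of size g, and together
they form the invertible Fourier matrix; for the Ricci matrix the eigenvalue at z = cis (2 pi k / g)
is -1 + (z + 1/z) / 2 = cos (2 pi k / g) - 1.

For the curvature at an edge xy of a cycle with constant weight c, the rotation taking x to y
transports one lazy measure to the other at cost c. If g >= 6, the distance f to the other neighbour
of x is 1-Lipschitz and increases by exactly c under this rotation on {x} and its neighbours (it runs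
through 0, c, 2c, 3c), so by duality the cost c is optimal. Hence every lazy curvature is 0. *)

theory Submission
  imports Defs
begin

section \<open>Circulant matrices and the Fourier matrix\<close>

text \<open>Substituting \<open>m = (j - i) mod n\<close> turns row \<open>i\<close> into row 0, and
  \<open>z ^ n = 1\<close> lets exponents be read modulo \<open>n\<close>. This is the eigenvector
  equation for the vector of powers of \<open>z\<close>.\<close>

lemma circulant_row_sum:
  fixes c :: "nat \<Rightarrow> 'a :: comm_semiring_1"
  assumes "i < n" "z ^ n = 1"
  shows "(\<Sum>j<n. c ((j + n - i) mod n) * z ^ j) = z ^ i * (\<Sum>m<n. c m * z ^ m)"
proof -
  have period: "z ^ (k mod n) = z ^ k" for k
    by (metis assms(2) mod_mult_div_eq mult_1_right power_add power_mult power_one)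
  have l: "((j + n - i) mod n + i) mod n = j" if "j < n" for j
    using assms(1) that by (simp add: mod_add_left_eq)
  have r: "((m + i) mod n + n - i) mod n = m" if "m < n" for m
    using assms(1) that by (auto simp: mod_if)
  have "(\<Sum>j<n. c ((j + n - i) mod n) * z ^ j) = (\<Sum>m<n. c m * z ^ (m + i))"
    using assms(1) period[of "_ + i"]
    by (intro sum.reindex_bij_witness[of _ "\<lambda>m. (m + i) mod n" "\<lambda>j. (j + n - i) mod n"])
      (auto simp: l r, metis l)
  then show ?thesis by (simp add: sum_distrib_left power_add mult_ac)
qed

text \<open>Orthogonality relations that invert the Fourier matrix: the summand is the
  \<open>k\<close>-th power of a single root of unity \<open>z\<close>, and the geometric sum
  vanishes unless \<open>z = 1\<close>.\<close>

lemma sum_roots_unity: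
  assumes "j < n" "l < n"
  shows "(\<Sum>k<n. cis (2 * pi * real k / real n) ^ j * cnj (cis (2 * pi * real k / real n)) ^ l) =
    (if j = l then of_nat n else 0)"
proof -
  define z where "z = cis (2 * pi * real j / real n) * cnj (cis (2 * pi * real l / real n))"
  have n: "n > 0" using assms by simp
  \<comment> \<open>Exchanging exponent and index makes the sum over \<open>k\<close>
    geometric.\<close>
  have swap: "cis (2 * pi * real k / real n) ^ j = cis (2 * pi * real j / real n) ^ k" for k j
    by (simp add: Complex.DeMoivre mult_ac)
  have "cis (2 * pi * real m / real n) ^ n = 1" for m
    using n by (simp add: Complex.DeMoivre)
  then have zn: "z ^ n = 1"
    by (simp add: z_def power_mult_distrib flip: complex_cnj_power)
  have "(\<Sum>k<n. cis (2 * pi * real k / real n) ^ j * cnj (cis (2 * pi * real k / real n)) ^ l) =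
      (\<Sum>k<n. z ^ k)"
    by (simp add: z_def power_mult_distrib swap flip: complex_cnj_power)
  also have "\<dots> = (if j = l then of_nat n else 0)"
  proof (cases "j = l")
    case True
    then have "z = 1" by (simp add: z_def cis_cnj cis_mult)
    with True show ?thesis by simp
  next
    case False
    \<comment> \<open>The indices \<open>j\<close> and \<open>l\<close> lie below \<open>n\<close>,
      so they name distinct roots of unity and their quotient \<open>z\<close> is not 1.\<close>
    have "inj_on (\<lambda>k. cis (2 * pi * real k / real n)) {..<n}"
      using Complex.bij_betw_roots_unity[OF n] by (auto simp: bij_betw_def)
    then have "cis (2 * pi * real j / real n) \<noteq> cis (2 * pi * real l / real n)"
      using assms False by (auto dest: inj_onD)
    moreover have "z = cis (2 * pi * real j / real n) / cis (2 * pi * real l / real n)"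
      by (simp add: z_def cis_cnj divide_inverse)
    ultimately have "z \<noteq> 1" by (metis cis_neq_zero divide_eq_1_iff)
    then show ?thesis using False zn by (simp add: geometric_sum)
  qed
  finally show ?thesis .
qed


text \<open>Conjugation by the Fourier matrix diagonalises the circulant. The characteristic
  polynomial, unlike the spectrum, also records multiplicities.\<close>

lemma char_poly_circulant_mat:
  fixes c :: "nat \<Rightarrow> complex"
  shows "char_poly (circulant_mat n c) =
    (\<Prod>k<n. [:- (\<Sum>j<n. c j * cis (2 * pi * real k / real n) ^ j), 1:])"
proof -
  define \<omega> where "\<omega> k = cis (2 * pi * real k / real n)" for k
  define ev where "ev k = (\<Sum>j<n. c j * \<omega> k ^ j)" for k
  define A where "A = circulant_mat n c"
  \<comment> \<open>Column \<open>k\<close> of \<open>F\<close> is the eigenvector of powers of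
    \<open>\<omega> k\<close>; \<open>F'\<close> is the conjugate transpose divided by
    \<open>n\<close>.\<close>
  define F where "F = Matrix.mat n n (\<lambda>(j, k). \<omega> k ^ j)"
  define F' where "F' = Matrix.mat n n (\<lambda>(k, l). cnj (\<omega> k) ^ l / of_nat n)"
  define D where "D = Matrix.mat n n (\<lambda>(j, k). if j = k then ev k else 0)"
  note defs = A_def F_def F'_def D_def circulant_mat_def
  have carrier: "A \<in> carrier_mat n n" "F \<in> carrier_mat n n" "F' \<in> carrier_mat n n"
      "D \<in> carrier_mat n n"
    by (simp_all add: defs)
  have "F * F' = 1\<^sub>m n"
    using sum_roots_unity[of _ n]
    by (intro eq_matI)
      (auto simp: defs scalar_prod_def \<omega>_def atLeast0LessThan simp flip: sum_divide_distrib)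
  \<comment> \<open>For square matrices a one-sided inverse is two-sided.\<close>
  moreover from this have "F' * F = 1\<^sub>m n"
    using carrier by (intro mat_mult_left_right_inverse[of F])
  moreover have AF: "A * F = F * D"
  proof (intro eq_matI)
    fix i k assume "i < dim_row (F * D)" "k < dim_col (F * D)"
    then have ik: "i < n" "k < n" by (simp_all add: defs)
    have "\<omega> k ^ n = 1" using ik by (simp add: \<omega>_def Complex.DeMoivre)
    from circulant_row_sum[OF ik(1) this, of c] ik
    show "(A * F) $$ (i, k) = (F * D) $$ (i, k)"
      by (simp add: defs scalar_prod_def ev_def atLeast0LessThan if_distrib cong: if_cong)
  qed (simp_all add: defs)
  ultimately have "A = F * D * F'"
    using carrier by (metis assoc_mult_mat right_mult_one_mat)
  with \<open>F * F' = 1\<^sub>m n\<close> \<open>F' * F = 1\<^sub>m n\<close> have "similar_mat A D"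
    using carrier by (intro similar_matI[of A D F F' n]) auto
  then have "char_poly A = char_poly D" by (rule char_poly_similar)
  also have "\<dots> = (\<Prod>a\<leftarrow>diag_mat D. [:- a, 1:])"
    by (rule char_poly_upper_triangular[OF carrier(4)]) (auto simp: defs upper_triangular_def)
  also have "diag_mat D = map ev [0..<n]"
    by (simp add: diag_mat_def D_def)
  also have "(\<Prod>a\<leftarrow>map ev [0..<n]. [:- a, 1:]) = (\<Prod>k<n. [:- ev k, 1:])"
    by (simp add: prod.list_conv_set_nth atLeast0LessThan)
  finally show ?thesis by (simp add: A_def ev_def \<omega>_def)
qed


section \<open>Distances and optimal transport along a translation\<close>

text \<open>Telescoping along the path. Since \<open>{u, v}\<close> is unordered, the hypothesis
  bounds the increment of \<open>f\<close> in both directions: \<open>f\<close> is a 1-Lipschitz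
  potential.\<close>

lemma path_weight_ge:
  assumes "successively (\<lambda>u v. {u, v} \<in> edges G) p" "p \<noteq> []"
    and "\<And>u v. {u, v} \<in> edges G \<Longrightarrow> f v - f u \<le> weight G {u, v}"
  shows "f (last p) - f (hd p) \<le> path_weight G p"
proof -
  have "f (last p) - f (hd p) = (\<Sum>i<length p - 1. f (p ! Suc i) - f (p ! i))"
    using assms(2) by (subst sum_lessThan_telescope) (simp add: last_conv_nth hd_conv_nth)
  also have "\<dots> \<le> path_weight G p"
    unfolding path_weight_def
    using assms(1) by (intro sum_mono assms(3)) (simp add: successively_conv_nth)
  finally show ?thesis .
qed

lemma gdist_ge:
  assumes "weighted_graph G" "x \<in> verts G" "y \<in> verts G"
    and "\<And>u v. {u, v} \<in> edges G \<Longrightarrow> f v - f u \<le> weight G {u, v}"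
  shows "f y - f x \<le> gdist G x y"
  unfolding gdist_def using assms path_weight_ge[of G _ f]
  by (intro cInf_greatest) (auto simp: weighted_graph_def paths_def)

lemma gdist_edge_le:
  assumes "weighted_graph G" "{x, y} \<in> edges G"
  shows "gdist G x y \<le> weight G {x, y}"
proof -
  have xy: "x \<noteq> y" "x \<in> verts G" "y \<in> verts G"
    using assms by (auto simp: weighted_graph_def)
  have "[x, y] \<in> paths G x y" using xy assms(2) by (simp add: paths_def)
  moreover have "path_weight G [x, y] = weight G {x, y}" by (simp add: path_weight_def)
  \<comment> \<open>The zero potential gives nonnegativity; a real \<open>Inf\<close> is known to
    lie below its elements only for sets bounded below.\<close>
  moreover have "0 \<le> path_weight G p" if "p \<in> paths G x y" for p
    using that assms(1) path_weight_ge[of G p "\<lambda>_. 0"]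
    by (fastforce simp: paths_def weighted_graph_def intro: less_imp_le)
  then have "bdd_below (path_weight G ` paths G x y)" by (auto intro!: bdd_belowI)
  ultimately show ?thesis
    unfolding gdist_def by (metis cInf_lower image_eqI)
qed

lemma edge_subset_verts:
  "weighted_graph G \<Longrightarrow> e \<in> edges G \<Longrightarrow> e \<subseteq> verts G"
  by (simp add: weighted_graph_def)

lemma neighbours_subset_verts:
  "weighted_graph G \<Longrightarrow> neighbours G x \<subseteq> verts G"
  by (auto simp: neighbours_def weighted_graph_def)

lemma finite_neighbours:
  "weighted_graph G \<Longrightarrow> finite (neighbours G x)"
  by (meson finite_subset neighbours_subset_verts weighted_graph_def)

lemma set_lazy_measure_subset:
  assumes "weighted_graph G" "neighbours G x \<noteq> {}"
  shows "set_pmf (lazy_measure G \<alpha> x) \<subseteq> insert x (neighbours G x)"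
  using set_pmf_of_set[OF assms(2) finite_neighbours[OF assms(1)]]
  by (auto simp: lazy_measure_def split: if_splits)

text \<open>\<open>\<sigma>\<close> acts on each branch of the mixture separately: the atom moves to
  \<open>\<sigma> x\<close>, and injectivity keeps the image of the uniform measure uniform.\<close>

lemma map_lazy_measure:
  assumes "finite (neighbours G x)" "neighbours G x \<noteq> {}" "inj_on \<sigma> (neighbours G x)"
    and "neighbours G (\<sigma> x) = \<sigma> ` neighbours G x"
  shows "map_pmf \<sigma> (lazy_measure G \<alpha> x) = lazy_measure G \<alpha> (\<sigma> x)"
  unfolding lazy_measure_def map_bind_pmf
  by (intro bind_pmf_cong refl) (simp add: assms map_pmf_of_set_inj)

text \<open>The easy half of Kantorovich duality: the potential \<open>f\<close> bounds the cost of
  every coupling below by \<open>c\<close>, and the coupling along \<open>\<sigma>\<close> attains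
  this bound.\<close>

lemma wasserstein_eq_translation:
  fixes f :: "'v \<Rightarrow> real"
  assumes G: "weighted_graph G"
    and supp: "set_pmf \<mu> \<subseteq> verts G" "\<And>u. u \<in> set_pmf \<mu> \<Longrightarrow> {u, \<sigma> u} \<in> edges G"
    and lip: "\<And>u v. {u, v} \<in> edges G \<Longrightarrow> f v - f u \<le> weight G {u, v}"
    and weight: "\<And>u. u \<in> set_pmf \<mu> \<Longrightarrow> weight G {u, \<sigma> u} = c"
    and f: "\<And>u. u \<in> set_pmf \<mu> \<Longrightarrow> f (\<sigma> u) = f u + c"
  shows "wasserstein G \<mu> (map_pmf \<sigma> \<mu>) = c"
proof -
  let ?\<nu> = "map_pmf \<sigma> \<mu>" and ?d = "\<lambda>(u, v). gdist G u v"
  have fin: "finite (set_pmf \<mu>)"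
    using G supp(1) finite_subset by (auto simp: weighted_graph_def)
  have lower: "c \<le> measure_pmf.expectation \<pi> ?d" if "\<pi> \<in> couplings \<mu> ?\<nu>" for \<pi>
  proof -
    from that have marg: "map_pmf fst \<pi> = \<mu>" "map_pmf snd \<pi> = ?\<nu>"
      by (auto simp: couplings_def)
    have in_supp: "u \<in> set_pmf \<mu>" "v \<in> set_pmf ?\<nu>" if "(u, v) \<in> set_pmf \<pi>" for u v
      using imageI[OF that, of fst] imageI[OF that, of snd] marg by (metis fst_conv snd_conv set_map_pmf)+
    then have "set_pmf \<pi> \<subseteq> set_pmf \<mu> \<times> set_pmf ?\<nu>" by auto
    then have "finite (set_pmf \<pi>)" by (rule finite_subset) (simp add: fin)
    then have int: "integrable \<pi> h" for h :: "'v \<times> 'v \<Rightarrow> real"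
      by (rule integrable_measure_pmf_finite)
    \<comment> \<open>The gain of \<open>f\<close> along \<open>\<sigma>\<close> is a difference of
      means. It depends on the marginals alone, so it can be evaluated on an arbitrary
      coupling.\<close>
    have "measure_pmf.expectation \<mu> (\<lambda>u. f u + c) = measure_pmf.expectation \<mu> (\<lambda>u. f (\<sigma> u))"
      by (intro integral_cong_AE) (auto simp: AE_measure_pmf_iff f)
    then have "c = measure_pmf.expectation ?\<nu> f - measure_pmf.expectation \<mu> f"
      by (simp add: integrable_measure_pmf_finite[OF fin])
    also have "\<dots> = measure_pmf.expectation (map_pmf snd \<pi>) f - measure_pmf.expectation (map_pmf fst \<pi>) f"
      by (simp only: marg)
    also have "\<dots> = measure_pmf.expectation \<pi> (\<lambda>(u, v). f v - f u)"
      by (simp add: case_prod_unfold int)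
    also have "\<dots> \<le> measure_pmf.expectation \<pi> ?d"
    proof (intro integral_mono_AE int, unfold AE_measure_pmf_iff, intro ballI)
      fix p assume p: "p \<in> set_pmf \<pi>"
      obtain u v where uv: "p = (u, v)" by fastforce
      have "u \<in> verts G" "v \<in> verts G"
        using in_supp[of u v] p supp unfolding uv set_map_pmf
        by (auto dest!: edge_subset_verts[OF G])
      then show "(\<lambda>(u, v). f v - f u) p \<le> ?d p"
        using gdist_ge[OF G _ _ lip] by (simp add: uv)
    qed
    finally show ?thesis .
  qed
  \<comment> \<open>All mass at \<open>u\<close> is sent along the edge to
    \<open>\<sigma> u\<close>.\<close>
  define \<pi> where "\<pi> = map_pmf (\<lambda>u. (u, \<sigma> u)) \<mu>"
  have \<pi>: "\<pi> \<in> couplings \<mu> ?\<nu>"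
    by (simp add: couplings_def \<pi>_def pmf.map_comp o_def)
  have "measure_pmf.expectation \<pi> ?d = measure_pmf.expectation \<mu> (\<lambda>u. gdist G u (\<sigma> u))"
    by (simp add: \<pi>_def)
  also have "\<dots> \<le> measure_pmf.expectation \<mu> (\<lambda>_. c)"
    using gdist_edge_le[OF G] supp(2) weight
    by (intro integral_mono_AE integrable_measure_pmf_finite fin)
      (force simp: AE_measure_pmf_iff)
  finally have upper: "measure_pmf.expectation \<pi> ?d \<le> c" by simp
  show ?thesis unfolding wasserstein_def
  proof (rule antisym)
    have "bdd_below ((\<lambda>\<pi>. measure_pmf.expectation \<pi> ?d) ` couplings \<mu> ?\<nu>)"
      using lower by (auto intro!: bdd_belowI)
    then show "(INF \<pi>\<in>couplings \<mu> ?\<nu>. measure_pmf.expectation \<pi> ?d) \<le> c"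
      using cINF_lower[OF _ \<pi>] upper by (meson order_trans)
    show "c \<le> (INF \<pi>\<in>couplings \<mu> ?\<nu>. measure_pmf.expectation \<pi> ?d)"
      using \<pi> lower by (intro cINF_greatest) auto
  qed
qed


text \<open>The transport cost and the distance from \<open>x\<close> to \<open>\<sigma> x\<close>
  both equal \<open>c\<close>, certified by the same \<open>f\<close>, so their ratio is 1. The
  conditions on \<open>\<sigma>\<close> concern only \<open>x\<close> and its neighbours.\<close>

lemma lazy_curvature_eq_0_translation:
  fixes f :: "'v \<Rightarrow> real"
  assumes G: "weighted_graph G" and edge: "{x, \<sigma> x} \<in> edges G"
    and inj: "inj_on \<sigma> (neighbours G x)"
    and aut: "neighbours G (\<sigma> x) = \<sigma> ` neighbours G x"
    and nbr: "\<And>u. u \<in> neighbours G x \<Longrightarrow> {u, \<sigma> u} \<in> edges G"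
    and weight: "\<And>e. e \<in> edges G \<Longrightarrow> weight G e = c"
    and lip: "\<And>u v. {u, v} \<in> edges G \<Longrightarrow> f v - f u \<le> c"
    and f: "\<And>u. u \<in> insert x (neighbours G x) \<Longrightarrow> f (\<sigma> u) = f u + c"
  shows "lazy_curvature G \<alpha> x (\<sigma> x) = 0"
proof -
  have verts: "x \<in> verts G" "\<sigma> x \<in> verts G" and c: "c > 0"
    using G edge weight[OF edge] by (auto simp: weighted_graph_def)
  have ne: "neighbours G x \<noteq> {}"
    using edge by (auto simp: neighbours_def)
  let ?\<mu> = "lazy_measure G \<alpha> x"
  have supp: "set_pmf ?\<mu> \<subseteq> insert x (neighbours G x)"
    by (rule set_lazy_measure_subset[OF G ne])
  have moved: "{u, \<sigma> u} \<in> edges G" if "u \<in> set_pmf ?\<mu>" for u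
    using that supp edge nbr by auto
  have "wasserstein G ?\<mu> (map_pmf \<sigma> ?\<mu>) = c"
  proof (rule wasserstein_eq_translation[OF G _ moved, where f = f])
    show "set_pmf ?\<mu> \<subseteq> verts G"
      using supp verts neighbours_subset_verts[OF G] by blast
    show "f v - f u \<le> weight G {u, v}" if "{u, v} \<in> edges G" for u v
      using lip weight that by simp
    show "weight G {u, \<sigma> u} = c" if "u \<in> set_pmf ?\<mu>" for u
      using weight moved that by simp
    show "f (\<sigma> u) = f u + c" if "u \<in> set_pmf ?\<mu>" for u
      using supp that by (intro f) auto
  qed
  moreover have "map_pmf \<sigma> ?\<mu> = lazy_measure G \<alpha> (\<sigma> x)"
    by (rule map_lazy_measure[OF finite_neighbours[OF G] ne inj aut])
  \<comment> \<open>\<open>f\<close> rises by \<open>c\<close> from \<open>x\<close> to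
    \<open>\<sigma> x\<close>, so the direct edge is a shortest path.\<close>
  moreover have "gdist G x (\<sigma> x) = c"
    using gdist_ge[OF G verts, of f] gdist_edge_le[OF G edge] lip f[of x] weight edge
    by fastforce
  ultimately show ?thesis using c by (simp add: lazy_curvature_def)
qed

section \<open>Rotations and curvature of the cycle\<close>

lemma cycle_graph_sel [simp]:
  "verts (cycle_graph g w) = {..<g}" "weight (cycle_graph g w) = w"
  by (simp_all add: cycle_graph_def)

lemma cycle_edge_iff:
  "{u, v} \<in> edges (cycle_graph g w) \<longleftrightarrow>
    u < g \<and> v = Suc u mod g \<or> v < g \<and> u = Suc v mod g"
  by (auto simp: cycle_graph_def cycle_edges_def doubleton_eq_iff image_iff)

lemma Suc_mod_cycle: "u < g \<Longrightarrow> Suc u mod g = (if Suc u = g then 0 else Suc u)"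
  by (simp add: mod_Suc)

text \<open>The inverse rotation on \<open>{..<g}\<close>; the wrap at 0 is explicit because
  subtraction on naturals truncates.\<close>

definition cycle_pred :: "nat \<Rightarrow> nat \<Rightarrow> nat" where
  "cycle_pred g u = (if u = 0 then g - 1 else u - 1)"

lemma neighbours_cycle_graph:
  assumes "x < g"
  shows "neighbours (cycle_graph g w) x = {Suc x mod g, cycle_pred g x}"
proof -
  have "y < g \<and> x = Suc y mod g \<longleftrightarrow> y = cycle_pred g x" for y
    using assms by (cases "y < g") (auto simp: Suc_mod_cycle cycle_pred_def)
  then show ?thesis using assms by (auto simp: neighbours_def cycle_edge_iff)
qed

text \<open>From length 3 on, successor and predecessor of a vertex differ.\<close>

lemma degree_of_cycle_graph:
  assumes "3 \<le> g" "x < g"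
  shows "degree_of (cycle_graph g w) x = 2"
proof -
  have "Suc x mod g \<noteq> cycle_pred g x"
    using assms by (auto simp: Suc_mod_cycle cycle_pred_def)
  then show ?thesis by (simp add: degree_of_def neighbours_cycle_graph[OF assms(2)])
qed

text \<open>For \<open>a\<close> and \<open>u\<close> below \<open>g\<close> this is the length of
  the shorter arc: one of the two truncated differences is 0, so \<open>d\<close> is the absolute
  difference.\<close>

definition cycle_dist :: "nat \<Rightarrow> nat \<Rightarrow> nat \<Rightarrow> nat" where
  "cycle_dist g a u = (let d = (u - a) + (a - u) in min d (g - d))"

lemma cycle_dist_edge:
  assumes "a < g" "{u, v} \<in> edges (cycle_graph g w)"
  shows "cycle_dist g a v \<le> Suc (cycle_dist g a u)"
proof -
  \<comment> \<open>An edge may be traversed in either direction, so both inequalities are proved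
    for the step from \<open>i\<close> to its successor.\<close>
  have "cycle_dist g a (Suc i mod g) \<le> Suc (cycle_dist g a i) \<and>
      cycle_dist g a i \<le> Suc (cycle_dist g a (Suc i mod g))" if "i < g" for i
    using that assms(1) unfolding cycle_dist_def Suc_mod_cycle[OF that] Let_def
    by (cases "Suc i = g") (auto simp: min_def split: nat_diff_split)
  then show ?thesis using assms(2) by (auto simp: cycle_edge_iff)
qed

text \<open>Stated for a rotation \<open>\<sigma>\<close> with inverse \<open>\<tau>\<close>, so
  that one argument covers both directions. The potential is \<open>c\<close> times the hop distance
  from \<open>\<tau> x\<close>, the neighbour behind \<open>x\<close>.\<close>

lemma lazy_curvature_cycle_graph_rotation:
  assumes g: "6 \<le> g" and c: "c > 0" and x: "x < g"
    and \<sigma>: "\<sigma> = (\<lambda>u. Suc u mod g) \<and> \<tau> = cycle_pred g \<or>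
      \<tau> = (\<lambda>u. Suc u mod g) \<and> \<sigma> = cycle_pred g"
  shows "lazy_curvature (cycle_graph g (\<lambda>_. c)) \<alpha> x (\<sigma> x) = 0"
proof -
  let ?G = "cycle_graph g (\<lambda>_. c)"
  have lt: "\<sigma> u < g" "\<tau> u < g" if "u < g" for u
    using g \<sigma> that by (auto simp: cycle_pred_def)
  have inv: "\<sigma> (\<tau> u) = u" "\<tau> (\<sigma> u) = u" if "u < g" for u
    using \<sigma> that by (auto simp: Suc_mod_cycle cycle_pred_def)
  have nbr: "neighbours ?G u = {\<sigma> u, \<tau> u}" if "u < g" for u
    using \<sigma> neighbours_cycle_graph[OF that] by auto
  have edge: "{u, \<sigma> u} \<in> edges ?G" if "u < g" for u
    using nbr[OF that] by (auto simp: neighbours_def)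
  let ?d = "cycle_dist g (\<tau> x)"
  \<comment> \<open>The cases separate \<open>x = 0\<close>, no wrap within two forward steps, a
    wrap at the second step, and a wrap at the first.\<close>
  consider "x = 0" | "0 < x" "Suc (Suc x) < g" | "0 < x" "g = Suc (Suc x)" | "0 < x" "g = Suc x"
    using x by linarith
  \<comment> \<open>The bound \<open>6 \<le> g\<close> enters in the value 3: the complementary arc
    has length \<open>g - 3\<close>, which must not be shorter.\<close>
  then have "?d (\<tau> x) = 0 \<and> ?d x = 1 \<and> ?d (\<sigma> x) = 2 \<and> ?d (\<sigma> (\<sigma> x)) = 3"
    using \<sigma> g by cases (elim disjE conjE; simp add: cycle_dist_def cycle_pred_def)+
  then have d: "?d (\<tau> x) = 0" "?d x = 1" "?d (\<sigma> x) = 2" "?d (\<sigma> (\<sigma> x)) = 3"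
    by simp_all
  show ?thesis
  proof (rule lazy_curvature_eq_0_translation[where c = c and f = "\<lambda>u. c * real (?d u)"])
    show "weighted_graph ?G" using g c by (intro weighted_graph_cycle) auto
    show "{x, \<sigma> x} \<in> edges ?G" using edge x .
    show "inj_on \<sigma> (neighbours ?G x)"
      unfolding nbr[OF x] by (rule inj_on_inverseI[of _ \<tau>]) (auto simp: inv lt x)
    show "neighbours ?G (\<sigma> x) = \<sigma> ` neighbours ?G x"
      using nbr[OF x] nbr[OF lt(1)[OF x]] inv x by simp
    show "{u, \<sigma> u} \<in> edges ?G" if "u \<in> neighbours ?G x" for u
      using that by (intro edge) (auto simp: nbr[OF x] lt[OF x])
    show "weight ?G e = c" for e by simp
    show "c * real (?d v) - c * real (?d u) \<le> c" if "{u, v} \<in> edges ?G" for u v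
    proof -
      have "real (?d v) \<le> real (?d u) + 1"
        using cycle_dist_edge[OF lt(2)[OF x] that] by simp
      from mult_left_mono[OF this, of c] c show ?thesis by (simp add: algebra_simps)
    qed
    show "c * real (?d (\<sigma> u)) = c * real (?d u) + c" if "u \<in> insert x (neighbours ?G x)" for u
      using that d inv x by (auto simp: nbr[OF x])
  qed
qed

lemma lazy_curvature_cycle_graph:
  assumes "6 \<le> g" "c > 0" "{x, y} \<in> edges (cycle_graph g (\<lambda>_. c))"
  shows "lazy_curvature (cycle_graph g (\<lambda>_. c)) \<alpha> x y = 0"
proof -
  have x: "x < g" using assms by (auto simp: cycle_edge_iff)
  have "y = Suc x mod g \<or> y = cycle_pred g x"
    using assms(3) neighbours_cycle_graph[OF x] by (auto simp: neighbours_def)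
  then show ?thesis
    using lazy_curvature_cycle_graph_rotation[OF assms(1,2) x] by blast
qed

section \<open>The Ricci matrix of the cycle and its spectrum\<close>

text \<open>For \<open>3 \<le> g\<close>, two indices cannot be each other's successor, so distinct
  edges share at most one vertex.\<close>

lemma cycle_edges_Int:
  assumes "3 \<le> g" "i < g" "j < g" "i \<noteq> j"
  shows "{i, Suc i mod g} \<inter> {j, Suc j mod g} =
    (if j = Suc i mod g then {j} else if i = Suc j mod g then {i} else {})"
  using assms by (auto simp: Suc_mod_cycle split: if_splits)

text \<open>Polymorphic because the Ricci matrix is real while its diagonalisation is
  complex.\<close>

definition cycle_coeff :: "nat \<Rightarrow> nat \<Rightarrow> 'a :: field" where
  "cycle_coeff g k = (if k = 0 then - 1 else if k = 1 \<or> k = g - 1 then 1 / 2 else 0)"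

lemma ricci_matrix_cycle_graph:
  assumes "3 \<le> g"
  shows "ricci_matrix (cycle_graph g w) (cycle_edges g) = circulant_mat g (cycle_coeff g)"
proof -
  let ?e = "\<lambda>i. {i, Suc i mod g}"
  have "ricci_entry (cycle_graph g w) (?e i) (?e j) = cycle_coeff g ((j + g - i) mod g)"
    if ij: "i < g" "j < g" for i j
  proof (cases "i = j")
    case True
    \<comment> \<open>The endpoints are distinct, so the diagonal sum has two terms, each
      1/2.\<close>
    have "i \<noteq> Suc i mod g" using ij assms by (auto simp: Suc_mod_cycle)
    then show ?thesis
      using True ij assms by (simp add: ricci_entry_def cycle_coeff_def degree_of_cycle_graph)
  next
    case False
    have neq: "?e i \<noteq> ?e j"
      using ij assms False by (auto simp: doubleton_eq_iff Suc_mod_cycle split: if_splits)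
    \<comment> \<open>Offsets 1 and -1 modulo \<open>g\<close> mean consecutive edges; offset 0 is
      excluded by \<open>i \<noteq> j\<close>.\<close>
    have "(j + g - i) mod g = 1 \<longleftrightarrow> j = Suc i mod g"
        "(j + g - i) mod g = g - 1 \<longleftrightarrow> i = Suc j mod g" "(j + g - i) mod g \<noteq> 0"
      using ij assms False by (auto simp: Suc_mod_cycle mod_if)
    then have coeff: "cycle_coeff g ((j + g - i) mod g) =
        (if j = Suc i mod g \<or> i = Suc j mod g then 1 / 2 else 0 :: real)"
      unfolding cycle_coeff_def by simp
    have entry: "ricci_entry (cycle_graph g w) (?e i) (?e j) =
        (if is_singleton (?e i \<inter> ?e j)
         then 1 / degree_of (cycle_graph g w) (the_elem (?e i \<inter> ?e j)) else 0)"
      using neq unfolding ricci_entry_def by (rule if_not_P)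
    consider "j = Suc i mod g" | "j \<noteq> Suc i mod g" "i = Suc j mod g"
      | "j \<noteq> Suc i mod g" "i \<noteq> Suc j mod g"
      by blast
    then show ?thesis
    proof cases
      case 1
      then have I: "?e i \<inter> ?e j = {j}" using cycle_edges_Int[OF assms ij False] by metis
      have "cycle_coeff g ((j + g - i) mod g) = (1 / 2 :: real)"
        unfolding coeff by (rule if_P) (use 1 in blast)
      then show ?thesis
        unfolding entry I using degree_of_cycle_graph[OF assms ij(2)] by simp
    next
      case 2
      then have I: "?e i \<inter> ?e j = {i}" using cycle_edges_Int[OF assms ij False] by metis
      have "cycle_coeff g ((j + g - i) mod g) = (1 / 2 :: real)"
        unfolding coeff by (rule if_P) (use 2 in blast)
      then show ?thesis
        unfolding entry I using degree_of_cycle_graph[OF assms ij(1)] by simp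
    next
      case 3
      then have "?e i \<inter> ?e j = {}" using cycle_edges_Int[OF assms ij False] by metis
      then show ?thesis unfolding entry coeff using 3 by (simp add: is_singleton_def)
    qed
  qed
  then show ?thesis
    by (intro eq_matI) (simp_all add: ricci_matrix_def circulant_mat_def cycle_edges_def)
qed

text \<open>The indices 0, 1 and \<open>g - 1\<close> are pairwise distinct once
  \<open>3 \<le> g\<close>, so three separate terms survive.\<close>

lemma sum_cycle_coeff:
  assumes "3 \<le> g"
  shows "(\<Sum>j<g. cycle_coeff g j * z ^ j) = - 1 + z / 2 + z ^ (g - 1) / 2"
proof -
  have "(\<Sum>j<g. cycle_coeff g j * z ^ j) = (\<Sum>j\<in>{0, 1, g - 1}. cycle_coeff g j * z ^ j)"
    using assms by (intro sum.mono_neutral_right) (auto simp: cycle_coeff_def)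
  also have "\<dots> = - 1 + z / 2 + z ^ (g - 1) / 2"
    using assms by (simp add: cycle_coeff_def)
  finally show ?thesis .
qed

text \<open>The Fourier diagonalisation lives over the complex numbers; the eigenvalues turn out
  real, so the factorisation pulls back along the injective \<open>of_real\<close>.\<close>

lemma char_poly_cycle_circulant:
  assumes "3 \<le> g"
  shows "char_poly (circulant_mat g (cycle_coeff g) :: real mat) =
    (\<Prod>k<g. [:- (cos (2 * pi * real k / real g) - 1), 1:])"
proof -
  interpret h: map_poly_inj_comm_ring_hom "of_real :: real \<Rightarrow> complex" ..
  let ?A = "circulant_mat g (cycle_coeff g) :: real mat"
  have ev: "(\<Sum>j<g. cycle_coeff g j * cis (2 * pi * real k / real g) ^ j) =
      of_real (cos (2 * pi * real k / real g) - 1)" for k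
  proof -
    define z where "z = cis (2 * pi * real k / real g)"
    have "z ^ g = 1"
      using assms by (simp add: z_def Complex.DeMoivre)
    then have "z * z ^ (g - 1) = 1"
      using assms power_minus_mult[of g z] by (simp add: mult.commute)
    moreover have "z * cnj z = 1" by (simp add: z_def cis_cnj cis_mult)
    moreover have "z \<noteq> 0" by (simp add: z_def)
    \<comment> \<open>Both sides invert \<open>z\<close>, so the two off-diagonal terms add up to
      the real part of \<open>z\<close>.\<close>
    ultimately have "z ^ (g - 1) = cnj z" by (metis mult_cancel_left)
    moreover have "z + cnj z = of_real (2 * cos (2 * pi * real k / real g))"
      by (simp add: complex_add_cnj z_def)
    moreover have "(\<Sum>j<g. cycle_coeff g j * z ^ j) = - 1 + (z + z ^ (g - 1)) / 2"
      using sum_cycle_coeff[OF assms, of z] by (simp add: add_divide_distrib)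
    ultimately show ?thesis unfolding z_def[symmetric] by simp
  qed
  have "map_poly of_real (char_poly ?A) = char_poly (map_mat complex_of_real ?A)"
    by (rule of_real_hom.char_poly_hom[symmetric, of _ g]) (simp add: circulant_mat_def)
  also have "map_mat complex_of_real ?A = circulant_mat g (cycle_coeff g)"
    by (intro eq_matI) (auto simp: circulant_mat_def cycle_coeff_def)
  also have "char_poly \<dots> = map_poly of_real (\<Prod>k<g. [:- (cos (2 * pi * real k / real g) - 1), 1:])"
    unfolding char_poly_circulant_mat ev h.hom_prod by (intro prod.cong refl) simp
  finally show ?thesis by simp
qed

text \<open>The case \<open>z = 1\<close> of the row sum, taken directly over the reals: -1 + 1/2 +
  1/2 = 0.\<close>

lemma eigenvector_cycle_circulant:
  assumes "3 \<le> g"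
  shows "eigenvector (circulant_mat g (cycle_coeff g) :: real mat) (Matrix.vec g (\<lambda>_. 1)) 0"
proof -
  have "(\<Sum>j<g. cycle_coeff g ((j + g - i) mod g)) = (0 :: real)" if "i < g" for i
    using circulant_row_sum[OF that, of "1 :: real" "cycle_coeff g"] sum_cycle_coeff[OF assms, of "1 :: real"]
    by simp
  moreover have "Matrix.vec g (\<lambda>_. 1 :: real) \<noteq> 0\<^sub>v g"
    using assms by (auto simp: vec_eq_iff intro!: exI[of _ 0])
  ultimately show ?thesis
    by (auto simp: eigenvector_def circulant_mat_def scalar_prod_def atLeast0LessThan)
qed

theorem proposition5p1:
  fixes g :: nat
  assumes "3 \<le> g"
  shows "(\<forall>w. (\<forall>e \<in> edges (cycle_graph g w). w e > 0) \<longrightarrow>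
      (let R = ricci_matrix (cycle_graph g w) (cycle_edges g);
           ev = (\<lambda>k::nat. cos (2 * pi * real k / real g) - 1)
       in R = circulant_mat g (\<lambda>k. if k = 0 then - 1 else if k = 1 \<or> k = g - 1 then 1 / 2 else 0) \<and>
          spectrum R = {ev k | k. k < g} \<and>
          char_poly R = (\<Prod>k<g. [:- ev k, 1:]) \<and>
          eigenvector R (Matrix.vec g (\<lambda>_. 1)) (ev 0) \<and>
          lambda_max R = ev 0 \<and>
          lambda_max R = 0)) \<and>
    (6 \<le> g \<longrightarrow> (\<forall>c::real. c > 0 \<longrightarrow>
      (\<forall>x y. {x, y} \<in> edges (cycle_graph g (\<lambda>_. c)) \<longrightarrow>
        has_LLY_curvature (cycle_graph g (\<lambda>_. c)) x y 0)))"
proof (intro conjI allI impI)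
  fix w :: "nat set \<Rightarrow> real"
  define R where "R = ricci_matrix (cycle_graph g w) (cycle_edges g)"
  define ev where "ev = (\<lambda>k::nat. cos (2 * pi * real k / real g) - 1)"
  have R: "R = circulant_mat g (cycle_coeff g)"
    unfolding R_def by (rule ricci_matrix_cycle_graph[OF assms])
  have carrier: "R \<in> carrier_mat g g" by (simp add: R circulant_mat_def)
  have cp: "char_poly R = (\<Prod>k<g. [:- ev k, 1:])"
    unfolding R ev_def by (rule char_poly_cycle_circulant[OF assms])
  \<comment> \<open>The eigenvalues are the roots of the characteristic polynomial, read off from
    its linear factors.\<close>
  have sp: "spectrum R = {ev k | k. k < g}"
    by (auto simp: spectrum_def eigenvalue_root_char_poly[OF carrier] cp poly_prod)
  have ev0: "ev 0 = 0" by (simp add: ev_def)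
  have "lambda_max R = 0"
    unfolding lambda_max_def sp
  proof (rule Max_eqI)
    show "0 \<in> {ev k | k. k < g}" using ev0 assms by force
    show "y \<le> 0" if "y \<in> {ev k | k. k < g}" for y using that by (auto simp: ev_def)
  qed simp
  then show "let R = ricci_matrix (cycle_graph g w) (cycle_edges g);
           ev = (\<lambda>k::nat. cos (2 * pi * real k / real g) - 1)
       in R = circulant_mat g (\<lambda>k. if k = 0 then - 1 else if k = 1 \<or> k = g - 1 then 1 / 2 else 0) \<and>
          spectrum R = {ev k | k. k < g} \<and>
          char_poly R = (\<Prod>k<g. [:- ev k, 1:]) \<and>
          eigenvector R (Matrix.vec g (\<lambda>_. 1)) (ev 0) \<and>
          lambda_max R = ev 0 \<and>
          lambda_max R = 0"
    unfolding Let_def R_def[symmetric] ev_def[symmetric]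
    using sp cp ev0 eigenvector_cycle_circulant[OF assms] R
    by (simp add: cycle_coeff_def[abs_def])
next
  fix c :: real and x y :: nat
  assume "6 \<le> g" "c > 0" "{x, y} \<in> edges (cycle_graph g (\<lambda>_. c))"
  \<comment> \<open>The quotient is 0 for every \<open>\<alpha>\<close>, so the limit exists
    trivially.\<close>
  then show "has_LLY_curvature (cycle_graph g (\<lambda>_. c)) x y 0"
    by (simp add: has_LLY_curvature_def lazy_curvature_cycle_graph)
qed

end
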